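(* For $15$ symbols, $9$ rows and $10$ columns: there is no transposed sesqui array, i.e. there is no $9\times 10$ row-column design on $15$ symbols (with replication number $6$) that satisfies both (CC) and (RC). There do, however, exist proper AO-arrays with these parameters, i.e. $9\times 10$ row-column designs on $15$ symbols satisfying (RC) but neither (RR) nor (CC).
   Context: A row-column design is an $r\times c$ array on $v$ symbols such that no symbol occurs more than once in any row or any column, and every symbol occurs exactly $e$ times in the array (so $ev=rc$). Identify rows and columns with their symbol sets. (RR): there is a constant $\lambda_{rr}$ such that any two distinct rows have exactly $\lambda_{rr}$ common symbols. (CC): there is a constant $\lambda_{cc}$ such that any two distinct columns have exactly $\lambda_{cc}$ common symbols. (RC): there is a constant $\lambda_{rc}$ such that any row and any column have exactly $\lambda_{rc}$ common symbols. *)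

theory Defs
  imports Main
begin

text \<open>An array with \<open>r\<close> rows and \<open>c\<close> columns is a function \<open>A\<close> with entry \<open>A i j\<close> in row \<open>i < r\<close> and
  column \<open>j < c\<close>; values outside this range are irrelevant.\<close>

definition row_symbols :: "nat \<Rightarrow> (nat \<Rightarrow> nat \<Rightarrow> 'a) \<Rightarrow> nat \<Rightarrow> 'a set" where
  "row_symbols c A i = {A i j | j. j < c}"

definition col_symbols :: "nat \<Rightarrow> (nat \<Rightarrow> nat \<Rightarrow> 'a) \<Rightarrow> nat \<Rightarrow> 'a set" where
  "col_symbols r A j = {A i j | i. i < r}"

definition row_column_design ::
    "nat \<Rightarrow> nat \<Rightarrow> 'a set \<Rightarrow> nat \<Rightarrow> (nat \<Rightarrow> nat \<Rightarrow> 'a) \<Rightarrow> bool" where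
  "row_column_design r c S e A \<longleftrightarrow>
     finite S \<and>
     (\<forall>i<r. \<forall>j<c. A i j \<in> S) \<and>
     (\<forall>i<r. inj_on (\<lambda>j. A i j) {..<c}) \<and>
     (\<forall>j<c. inj_on (\<lambda>i. A i j) {..<r}) \<and>
     (\<forall>s\<in>S. card {(i, j). i < r \<and> j < c \<and> A i j = s} = e)"

definition RR :: "nat \<Rightarrow> nat \<Rightarrow> (nat \<Rightarrow> nat \<Rightarrow> 'a) \<Rightarrow> bool" where
  "RR r c A \<longleftrightarrow> (\<exists>l. \<forall>i<r. \<forall>i'<r. i \<noteq> i' \<longrightarrow> card (row_symbols c A i \<inter> row_symbols c A i') = l)"

definition CC :: "nat \<Rightarrow> nat \<Rightarrow> (nat \<Rightarrow> nat \<Rightarrow> 'a) \<Rightarrow> bool" where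
  "CC r c A \<longleftrightarrow> (\<exists>l. \<forall>j<c. \<forall>j'<c. j \<noteq> j' \<longrightarrow> card (col_symbols r A j \<inter> col_symbols r A j') = l)"

definition RC :: "nat \<Rightarrow> nat \<Rightarrow> (nat \<Rightarrow> nat \<Rightarrow> 'a) \<Rightarrow> bool" where
  "RC r c A \<longleftrightarrow> (\<exists>l. \<forall>i<r. \<forall>j<c. card (row_symbols c A i \<inter> col_symbols r A j) = l)"

definition transposed_sesqui_array ::
    "nat \<Rightarrow> nat \<Rightarrow> 'a set \<Rightarrow> nat \<Rightarrow> (nat \<Rightarrow> nat \<Rightarrow> 'a) \<Rightarrow> bool" where
  "transposed_sesqui_array r c S e A \<longleftrightarrow> row_column_design r c S e A \<and> CC r c A \<and> RC r c A"

definition proper_AO_array ::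
    "nat \<Rightarrow> nat \<Rightarrow> 'a set \<Rightarrow> nat \<Rightarrow> (nat \<Rightarrow> nat \<Rightarrow> 'a) \<Rightarrow> bool" where
  "proper_AO_array r c S e A \<longleftrightarrow>
     row_column_design r c S e A \<and> RC r c A \<and> \<not> RR r c A \<and> \<not> CC r c A"

end

theory Submission
  imports Defs
begin

text \<open>
  Nonexistence. The sets of columns missing a given symbol form the blocks of a 2-(10,4,2) design.
  Following Hall and Connor, two distinct blocks \<open>s\<close>, \<open>t\<close> meet in one or two points, since the
  integers \<open>(|s \<inter> t| - 1) (|s \<inter> t| - 2)\<close> sum to zero over all \<open>t\<close>; the relation of meeting in one
  point is a strongly regular graph with parameters (15,8,4,4). By (RC), the five symbols missing
  from a row form a clique in which every other vertex has exactly two neighbours. Two such cliques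
  are never disjoint, and distinct ones share at most one vertex. Counting the incidences of the
  nine cliques with one of them shows that each is repeated at least twice, so two distinct ones
  sharing a vertex would cover it at least four times, whereas every symbol is missing from only
  three rows.

  Existence. Split the symbols into three parts of size five. In the example, three rows avoid each
  part, and each column avoids one pair of every part, the ten columns realising the ten pairs.
\<close>

text \<open>Double count of the pairs \<open>(i, y)\<close> with \<open>y\<close> in
  \<open>F i\<close>. Every parameter count below rests on it.\<close>

lemma sum_card_Int_swap:
  assumes "finite I" "finite Y"
  shows "(\<Sum>i\<in>I. card (F i \<inter> Y)) = (\<Sum>y\<in>Y. card {i \<in> I. y \<in> F i})"
proof -
  have "(\<Sum>i\<in>I. card (F i \<inter> Y)) = (\<Sum>i\<in>I. \<Sum>y\<in>Y. of_bool (y \<in> F i))"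
    using assms by (intro sum.cong refl) (simp add: Int_commute Int_def)
  also have "\<dots> = (\<Sum>y\<in>Y. \<Sum>i\<in>I. of_bool (y \<in> F i))"
    by (rule sum.swap)
  also have "\<dots> = (\<Sum>y\<in>Y. card {i \<in> I. y \<in> F i})"
    using assms by (intro sum.cong refl) (simp add: Int_def)
  finally show ?thesis .
qed

section \<open>Regular cliques in a strongly regular graph\<close>

locale srg_15_8_4_4 =
  fixes V :: "'a set" and N :: "'a \<Rightarrow> 'a set"
  assumes finite_V: "finite V" and card_V: "card V = 15"
    and N_subset: "v \<in> V \<Longrightarrow> N v \<subseteq> V - {v}"
    and N_sym: "u \<in> V \<Longrightarrow> v \<in> V \<Longrightarrow> u \<in> N v \<longleftrightarrow> v \<in> N u"
    and card_N: "v \<in> V \<Longrightarrow> card (N v) = 8"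
    and card_common: "u \<in> V \<Longrightarrow> v \<in> V \<Longrightarrow> u \<noteq> v \<Longrightarrow> card (N u \<inter> N v) = 4"
begin

text \<open>The model is the triangular graph T(6), which has these parameters: the five edges of K6
  through a fixed point form such a clique.\<close>

definition regular_clique :: "'a set \<Rightarrow> bool" where
  "regular_clique X \<longleftrightarrow> X \<subseteq> V \<and> card X = 5 \<and> (\<forall>b\<in>X. X - {b} \<subseteq> N b) \<and>
     (\<forall>b\<in>V - X. card (N b \<inter> X) = 2)"

lemma regular_cliqueD:
  assumes "regular_clique X"
  shows "X \<subseteq> V" "card X = 5" "finite X" "b \<in> X \<Longrightarrow> X - {b} \<subseteq> N b"
    "b \<in> V \<Longrightarrow> b \<notin> X \<Longrightarrow> card (N b \<inter> X) = 2"
  using assms finite_V unfolding regular_clique_def by (auto intro: finite_subset)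

text \<open>Of the four common neighbours of \<open>b\<close> and \<open>b'\<close>, three are the
  remaining members of \<open>X\<close>.\<close>

lemma card_common_outside:
  assumes "regular_clique X" "b \<in> X" "b' \<in> X" "b \<noteq> b'"
  shows "card (N b \<inter> N b' - X) = 1"
proof -
  note X = regular_cliqueD[OF assms(1)]
  have bV: "b \<in> V" "b' \<in> V" using X(1) assms by auto
  have "N b \<inter> N b' \<inter> X = X - {b, b'}"
    using X(4)[OF assms(2)] X(4)[OF assms(3)] N_subset[OF bV(1)] N_subset[OF bV(2)] by blast
  moreover have "card (X - {b, b'}) = 3"
    using X assms by (simp add: card_Diff_subset)
  moreover have "card (N b \<inter> N b' - X) = card (N b \<inter> N b') - card (N b \<inter> N b' \<inter> X)"
    by (rule card_Diff_subset_Int) (use X(3) in auto)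
  ultimately show ?thesis using card_common[OF bV assms(4)] by simp
qed

text \<open>If the cliques differ, a vertex of \<open>Y\<close> outside \<open>X\<close> has only
  two neighbours in \<open>X\<close>, so they share exactly two vertices. The other three vertices
  of \<open>Y\<close> are then common neighbours of these two outside \<open>X\<close>, where only
  one exists.\<close>

lemma regular_cliques_eq:
  assumes "regular_clique X" "regular_clique Y" "2 \<le> card (X \<inter> Y)"
  shows "X = Y"
proof (rule ccontr)
  assume "X \<noteq> Y"
  note X = regular_cliqueD[OF assms(1)] and Y = regular_cliqueD[OF assms(2)]
  have "\<not> Y \<subseteq> X"
    using \<open>X \<noteq> Y\<close> X(2,3) Y(2) by (metis card_subset_eq)
  then obtain c where c: "c \<in> Y" "c \<notin> X" by auto
  have "X \<inter> Y \<subseteq> N c \<inter> X" using Y(4)[OF c(1)] c by auto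
  moreover have "card (N c \<inter> X) = 2" using X(5) c Y(1) by auto
  ultimately have "card (X \<inter> Y) \<le> 2"
    using X(3) by (metis card_mono finite_Int)
  then have two: "card (X \<inter> Y) = 2" using assms(3) by simp
  then obtain b b' where b: "X \<inter> Y = {b, b'}" "b \<noteq> b'"
    by (auto simp: card_2_iff)
  have "Y - X \<subseteq> N b \<inter> N b' - X"
    using b Y(4)[of b] Y(4)[of b'] by auto
  moreover have "card (N b \<inter> N b' - X) = 1"
    using card_common_outside[OF assms(1)] b by blast
  \<comment> \<open>Monotonicity needs the larger set to be finite; it is, because its cardinality
    is not 0.\<close>
  ultimately have "card (Y - X) \<le> 1"
    by (metis card.infinite card_mono zero_neq_one)
  moreover have "card (Y - X) = card Y - card (X \<inter> Y)"
    using Y(3) by (metis card_Diff_subset_Int finite_Int inf_commute)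
  ultimately show False using two Y(2) by simp
qed

text \<open>If \<open>X\<close> and \<open>Y\<close> were disjoint, a vertex \<open>b\<close> of
  \<open>X\<close> would have 4 + 2 neighbours in them, hence a neighbour \<open>z\<close> outside
  both. It turns out that \<open>b\<close> and \<open>z\<close> have the same two neighbours in
  \<open>Y\<close>; these two would then have two common neighbours outside \<open>Y\<close>,
  against \<open>card_common_outside\<close>.\<close>

lemma regular_cliques_meet:
  assumes "regular_clique X" "regular_clique Y"
  shows "X \<inter> Y \<noteq> {}"
proof
  assume disj: "X \<inter> Y = {}"
  note X = regular_cliqueD[OF assms(1)] and Y = regular_cliqueD[OF assms(2)]
  obtain b where b: "b \<in> X" using X(2) by fastforce
  have bV: "b \<in> V" and bY: "b \<notin> Y" using b X(1) disj by auto
  have fN: "finite (N v)" if "v \<in> V" for v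
    using N_subset[OF that] finite_V by (meson finite_Diff finite_subset)
  have NbX: "N b \<inter> X = X - {b}" using X(4)[OF b] N_subset[OF bV] by auto
  have NbY: "card (N b \<inter> Y) = 2" using Y(5) bV bY by auto
  have "\<not> N b \<subseteq> (N b \<inter> X) \<union> (N b \<inter> Y)"
  proof
    assume "N b \<subseteq> (N b \<inter> X) \<union> (N b \<inter> Y)"
    then have "card (N b) \<le> card ((N b \<inter> X) \<union> (N b \<inter> Y))"
      using X(3) Y(3) by (intro card_mono) auto
    also have "\<dots> \<le> card (N b \<inter> X) + card (N b \<inter> Y)" by (rule card_Un_le)
    also have "\<dots> = 6" using NbX NbY X b by simp
    finally show False using card_N[OF bV] by simp
  qed
  then obtain z where z: "z \<in> N b" "z \<notin> X" "z \<notin> Y" by auto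
  have zV: "z \<in> V" "z \<noteq> b" using z N_subset[OF bV] by auto
  \<comment> \<open>A vertex \<open>y\<close> of \<open>Y\<close> adjacent to \<open>z\<close> but
    not to \<open>b\<close> would share five neighbours with \<open>b\<close> instead of four: its
    two neighbours in \<open>X\<close>, the two neighbours of \<open>b\<close> in \<open>Y\<close>,
    and \<open>z\<close>.\<close>
  have "N z \<inter> Y \<subseteq> N b \<inter> Y"
  proof (rule ccontr)
    assume "\<not> ?thesis"
    then obtain y where y: "y \<in> N z" "y \<in> Y" "y \<notin> N b" by auto
    have yV: "y \<in> V" "y \<noteq> b" "y \<notin> X" using y Y(1) bY disj by auto
    have "b \<notin> N y" using y(3) N_sym[OF yV(1) bV] by simp
    then have "N y \<inter> X \<subseteq> N b" using X(4)[OF b] by auto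
    moreover have "N b \<inter> Y \<subseteq> N y" using Y(4)[OF y(2)] y(3) by auto
    moreover have "z \<in> N y" using N_sym[OF yV(1) zV(1)] y(1) by simp
    ultimately have "insert z ((N y \<inter> X) \<union> (N b \<inter> Y)) \<subseteq> N b \<inter> N y"
      using z(1) by auto
    then have "card (insert z ((N y \<inter> X) \<union> (N b \<inter> Y))) \<le> card (N b \<inter> N y)"
      using fN[OF bV] by (intro card_mono) auto
    moreover have "card ((N y \<inter> X) \<union> (N b \<inter> Y)) = 2 + 2"
      using X(5)[OF yV(1,3)] NbY X(3) Y(3) disj by (subst card_Un_disjoint) auto
    ultimately show False
      using card_common[OF bV yV(1)] yV(2) z X(3) Y(3) by (simp add: card_insert_if)
  qed
  moreover have "card (N z \<inter> Y) = 2" using Y(5) zV z by auto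
  ultimately have eq: "N z \<inter> Y = N b \<inter> Y"
    using NbY Y(3) by (intro card_subset_eq) auto
  obtain y1 y2 where y: "N b \<inter> Y = {y1, y2}" "y1 \<noteq> y2"
    using NbY by (auto simp: card_2_iff)
  have yY: "y1 \<in> Y" "y2 \<in> Y" "y1 \<in> V" "y2 \<in> V" using y Y(1) by auto
  have "{b, z} \<subseteq> N y1 \<inter> N y2 - Y"
    using y eq N_sym[of _ y1] N_sym[of _ y2] yY bV zV z bY by auto
  then have "card {b, z} \<le> card (N y1 \<inter> N y2 - Y)"
    using fN yY by (intro card_mono) auto
  then show False
    using card_common_outside[OF assms(2) yY(1,2) y(2)] zV by simp
qed

lemma no_triple_cover:
  assumes clique: "\<And>i. i < 9 \<Longrightarrow> regular_clique (X i)"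
    and cover: "\<And>v. v \<in> V \<Longrightarrow> card {i \<in> {..<9::nat}. v \<in> X i} = 3"
  shows False
proof -
  \<comment> \<open>Indices are counted rather than sets, since the family may repeat a
    clique.\<close>
  define same where "same i = {j \<in> {..<9}. X j = X i}" for i
  have same: "2 \<le> card (same i)" if i: "i < 9" for i
  proof -
    note Xi = regular_cliqueD[OF clique[OF i]]
    have "15 = (\<Sum>v\<in>X i. card {j \<in> {..<9}. v \<in> X j})"
      using cover Xi by (simp add: subset_iff)
    also have "\<dots> = (\<Sum>j<9. card (X j \<inter> X i))"
      using Xi(3) by (simp add: sum_card_Int_swap)
    \<comment> \<open>A copy of \<open>X i\<close> contributes 5 and any other clique at most 1.
      With m copies, 15 <= 9 + 4m forces m >= 2.\<close>
    also have "\<dots> \<le> (\<Sum>j<9. 1 + 4 * of_bool (X j = X i))"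
    proof (rule sum_mono)
      fix j :: nat assume "j \<in> {..<9}"
      then show "card (X j \<inter> X i) \<le> 1 + 4 * of_bool (X j = X i)"
        using regular_cliques_eq[OF clique clique[OF i], of j] Xi(2) by fastforce
    qed
    also have "\<dots> = 9 + 4 * card (same i)"
      unfolding sum.distrib sum_distrib_left[symmetric]
      by (simp add: same_def Int_def)
    finally show ?thesis by simp
  qed
  have X0: "X 0 \<subseteq> V" "card (X 0) = 5" using regular_cliqueD[OF clique] by auto
  then have "V \<noteq> X 0" using card_V by auto
  then obtain c where c: "c \<in> V" "c \<notin> X 0" using X0(1) by blast
  have "{i \<in> {..<9::nat}. c \<in> X i} \<noteq> {}"
    using cover[OF c(1)] by (metis card.empty zero_neq_numeral)
  then obtain j where j: "j < 9" "c \<in> X j" by auto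
  obtain b where b: "b \<in> X 0" "b \<in> X j"
    using regular_cliques_meet[OF clique clique[OF j(1)], of 0] by auto
  \<comment> \<open>The common vertex \<open>b\<close> lies in all copies of both cliques, at least
    2 + 2 of them, but may lie in only three.\<close>
  have "same 0 \<union> same j \<subseteq> {i \<in> {..<9}. b \<in> X i}" using b by (auto simp: same_def)
  then have "card (same 0 \<union> same j) \<le> 3"
    using cover[of b] b X0 card_mono[of "{i \<in> {..<9}. b \<in> X i}"] by fastforce
  moreover have "same 0 \<inter> same j = {}" using c j by (auto simp: same_def)
  then have "card (same 0 \<union> same j) = card (same 0) + card (same j)"
    by (intro card_Un_disjoint) (auto simp: same_def)
  ultimately show False using same[of 0] same[OF j(1)] by simp
qed

end

section \<open>The block graph of a 2-(10,4,2) design\<close>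

locale design_10_4_2 =
  fixes V :: "'a set" and P :: "'b set" and K :: "'a \<Rightarrow> 'b set"
  assumes finite_V: "finite V" and card_V: "card V = 15" and finite_P: "finite P"
    and K_subset: "s \<in> V \<Longrightarrow> K s \<subseteq> P"
    and card_K: "s \<in> V \<Longrightarrow> card (K s) = 4"
    and card_point: "p \<in> P \<Longrightarrow> card {s \<in> V. p \<in> K s} = 6"
    and card_pair: "p \<in> P \<Longrightarrow> q \<in> P \<Longrightarrow> p \<noteq> q \<Longrightarrow> card {s \<in> V. p \<in> K s \<and> q \<in> K s} = 2"
begin

text \<open>The Gram matrix of the incidence vectors of the blocks, with integer entries because
  differences such as \<open>g s u - 2\<close> occur.\<close>

definition g :: "'a \<Rightarrow> 'a \<Rightarrow> int" where
  "g s t = int (card (K s \<inter> K t))"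

definition N :: "'a \<Rightarrow> 'a set" where
  "N s = {t \<in> V - {s}. g s t = 1}"

lemma finite_K: "s \<in> V \<Longrightarrow> finite (K s)"
  using K_subset finite_P finite_subset by blast

lemma g_commute: "g s t = g t s"
  by (simp add: g_def Int_commute)

lemma g_self: "s \<in> V \<Longrightarrow> g s s = 4"
  by (simp add: g_def card_K)

text \<open>Needed twice: for \<open>W = V\<close> with \<open>k = 6\<close>, and for a prospective
  clique \<open>W\<close> with \<open>k = 2\<close>.\<close>

lemma sum_g:
  assumes "s \<in> V" "W \<subseteq> V" "\<And>p. p \<in> K s \<Longrightarrow> card {t \<in> W. p \<in> K t} = k"
  shows "(\<Sum>t\<in>W. g s t) = 4 * int k"
proof -
  have "(\<Sum>t\<in>W. card (K t \<inter> K s)) = (\<Sum>p\<in>K s. card {t \<in> W. p \<in> K t})"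
    using assms finite_V finite_K by (intro sum_card_Int_swap) (auto intro: finite_subset)
  also have "\<dots> = 4 * k" using assms by (simp add: card_K)
  finally show ?thesis
    unfolding g_def of_nat_sum[symmetric] by (simp add: Int_commute)
qed

lemma sum_g_V: "s \<in> V \<Longrightarrow> (\<Sum>t\<in>V. g s t) = 24"
  using sum_g[of s V 6] card_point K_subset by force

text \<open>Let M be the point-block incidence matrix and G = M^T M. Since M M^T = 4I + 2J, the
  square of G is 4G + 2 M^T J M, and the last term has all entries 2 * 4 * 4 = 32.\<close>

lemma sum_g_mult:
  assumes s: "s \<in> V" and u: "u \<in> V"
  shows "(\<Sum>t\<in>V. g s t * g t u) = 32 + 4 * g s u"
proof -
  have "(\<Sum>t\<in>V. g s t * g t u) = (\<Sum>t\<in>V. \<Sum>p\<in>K s. \<Sum>q\<in>K u. of_bool (p \<in> K t \<and> q \<in> K t))"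
  proof (rule sum.cong)
    fix t assume "t \<in> V"
    have "g s t = (\<Sum>p\<in>K s. of_bool (p \<in> K t))" "g t u = (\<Sum>q\<in>K u. of_bool (q \<in> K t))"
      using finite_K s u by (simp_all add: g_def Int_commute Int_def conj_commute)
    then show "g s t * g t u = (\<Sum>p\<in>K s. \<Sum>q\<in>K u. of_bool (p \<in> K t \<and> q \<in> K t))"
      by (simp add: sum_product of_bool_conj)
  qed simp
  also have "\<dots> = (\<Sum>p\<in>K s. \<Sum>t\<in>V. \<Sum>q\<in>K u. of_bool (p \<in> K t \<and> q \<in> K t))"
    by (rule sum.swap)
  also have "\<dots> = (\<Sum>p\<in>K s. \<Sum>q\<in>K u. \<Sum>t\<in>V. of_bool (p \<in> K t \<and> q \<in> K t))"
    by (intro sum.cong refl sum.swap)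
  also have "\<dots> = (\<Sum>p\<in>K s. \<Sum>q\<in>K u. 2 + 4 * of_bool (q = p))"
  proof (intro sum.cong refl)
    fix p q assume pq: "p \<in> K s" "q \<in> K u"
    then have "p \<in> P" "q \<in> P" using K_subset s u by auto
    then have "card {t \<in> V. p \<in> K t \<and> q \<in> K t} = 2 + 4 * of_bool (q = p)"
      using card_point[of p] card_pair[of p q] by auto
    then show "(\<Sum>t\<in>V. of_bool (p \<in> K t \<and> q \<in> K t)) = (2 + 4 * of_bool (q = p) :: int)"
      using finite_V by (simp add: Int_def)
  qed
  also have "\<dots> = (\<Sum>p\<in>K s. 8 + 4 * of_bool (p \<in> K u))"
  proof (rule sum.cong)
    fix p
    have "K u \<inter> {q. q = p} = (if p \<in> K u then {p} else {})" by auto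
    then show "(\<Sum>q\<in>K u. 2 + 4 * of_bool (q = p)) = (8 + 4 * of_bool (p \<in> K u) :: int)"
      unfolding sum.distrib sum_distrib_left[symmetric]
      using finite_K[OF u] card_K[OF u] by simp
  qed simp
  also have "\<dots> = 32 + 4 * g s u"
    unfolding sum.distrib sum_distrib_left[symmetric]
    using finite_K[OF s] card_K[OF s] by (simp add: g_def Int_def)
  finally show ?thesis .
qed

text \<open>The sum over all of \<open>V\<close> is 48 - 3 * 24 + 2 * 15 = 6, which the term
  \<open>u = s\<close> already contributes as (4 - 1)(4 - 2). The other terms are nonnegative, no
  integer lying strictly between 1 and 2, so they all vanish.\<close>

lemma g_cases:
  assumes s: "s \<in> V" and t: "t \<in> V" "t \<noteq> s"
  shows "g s t = 1 \<or> g s t = 2"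
proof -
  have "(\<Sum>u\<in>V. (g s u - 1) * (g s u - 2)) =
      (\<Sum>u\<in>V. g s u * g u s) - 3 * (\<Sum>u\<in>V. g s u) + 2 * int (card V)"
    by (simp add: sum_distrib_left g_commute[of _ s] algebra_simps sum.distrib sum_subtractf)
  also have "\<dots> = 6" using s by (simp add: sum_g_V sum_g_mult g_self card_V)
  finally have "(\<Sum>u\<in>V - {s}. (g s u - 1) * (g s u - 2)) = 0"
    using s finite_V by (simp add: sum_diff1 g_self)
  moreover have nonneg: "0 \<le> (x - 1) * (x - 2)" for x :: int
    by (cases "x \<le> 1") (auto simp: zero_le_mult_iff)
  ultimately have "(g s t - 1) * (g s t - 2) = 0"
    using finite_V t by (subst (asm) sum_nonneg_eq_0_iff) auto
  then show ?thesis by auto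
qed

text \<open>Adjacency is thus affine in \<open>g\<close>, which reduces degrees and common
  neighbours to the sums of \<open>g\<close> and of its products.\<close>

lemma of_bool_N:
  assumes "s \<in> V" "t \<in> V" "t \<noteq> s"
  shows "of_bool (t \<in> N s) = 2 - g s t"
  using g_cases[OF assms] assms by (auto simp: N_def)

lemma card_N_Int:
  assumes "s \<in> V" "W \<subseteq> V - {s}"
  shows "int (card (N s \<inter> W)) = 2 * int (card W) - (\<Sum>t\<in>W. g s t)"
proof -
  have fW: "finite W" using assms finite_V by (meson finite_Diff finite_subset)
  then have "int (card (N s \<inter> W)) = (\<Sum>t\<in>W. of_bool (t \<in> N s))"
    by (simp add: Int_commute Int_def conj_commute)
  also have "\<dots> = (\<Sum>t\<in>W. 2 - g s t)"
    using assms by (intro sum.cong of_bool_N) auto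
  finally show ?thesis by (simp add: sum_subtractf)
qed

sublocale srg_15_8_4_4 V N
proof
  show "finite V" "card V = 15" by (fact finite_V card_V)+
  show "N v \<subseteq> V - {v}" for v by (auto simp: N_def)
  show "u \<in> N v \<longleftrightarrow> v \<in> N u" if "u \<in> V" "v \<in> V" for u v
    using that by (auto simp: N_def g_commute)
  show "card (N v) = 8" if v: "v \<in> V" for v
  proof -
    have "N v \<inter> (V - {v}) = N v" by (auto simp: N_def)
    then have "int (card (N v)) = 2 * int (card (V - {v})) - (\<Sum>t\<in>V - {v}. g v t)"
      using card_N_Int[OF v subset_refl] by simp
    \<comment> \<open>This is 2 * 14 - (24 - 4).\<close>
    also have "\<dots> = 8"
      using v finite_V by (simp add: sum_diff1 sum_g_V g_self card_V)
    finally show ?thesis by simp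
  qed
  show "card (N u \<inter> N v) = 4" if u: "u \<in> V" and v: "v \<in> V" and uv: "u \<noteq> v" for u v
  proof -
    let ?W = "V - {u} - {v}"
    have fW: "finite ?W" using finite_V by simp
    have sum_W: "(\<Sum>t\<in>?W. f t) = (\<Sum>t\<in>V. f t) - f u - f v" for f :: "'a \<Rightarrow> int"
      using u v uv finite_V by (simp add: sum_diff1)
    have "N u \<inter> N v = ?W \<inter> {t. t \<in> N u \<and> t \<in> N v}" by (auto simp: N_def)
    then have "int (card (N u \<inter> N v)) = (\<Sum>t\<in>?W. of_bool (t \<in> N u \<and> t \<in> N v))"
      using fW by simp
    also have "\<dots> = (\<Sum>t\<in>?W. (2 - g u t) * (2 - g v t))"
      using u v by (intro sum.cong refl) (simp add: of_bool_conj of_bool_N)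
    also have "\<dots> = (\<Sum>t\<in>?W. 4 - 2 * g u t - 2 * g v t + g u t * g t v)"
      by (intro sum.cong refl) (simp add: g_commute[of _ v] algebra_simps)
    also have "\<dots> = 4 * int (card ?W) - 2 * (\<Sum>t\<in>?W. g u t) - 2 * (\<Sum>t\<in>?W. g v t)
        + (\<Sum>t\<in>?W. g u t * g t v)"
      by (simp add: sum.distrib sum_subtractf sum_distrib_left)
    \<comment> \<open>With x = \<open>g u v\<close> this reads 4 * 13 - 4(20 - x) + (32 + 4x - 8x).
      The x cancels, so adjacent and nonadjacent pairs give the same number.\<close>
    also have "\<dots> = 4"
      unfolding sum_W using u v uv finite_V
      by (simp add: sum_g_V sum_g_mult g_self card_V g_commute[of v u])
    finally show ?thesis by simp
  qed
qed

text \<open>The entries \<open>g s t\<close> over \<open>X\<close> sum to 4 * 2 = 8. A member of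
  \<open>X\<close> therefore has 2 * 4 - (8 - 4) = 4 neighbours in \<open>X\<close>, that is, all
  other members, and an outside vertex has 2 * 5 - 8 = 2.\<close>

lemma regular_cliqueI:
  assumes X: "X \<subseteq> V" "card X = 5" and two: "\<And>p. p \<in> P \<Longrightarrow> card {t \<in> X. p \<in> K t} = 2"
  shows "regular_clique X"
proof -
  have fX: "finite X" using X finite_V finite_subset by blast
  have sum8: "(\<Sum>t\<in>X. g s t) = 8" if s: "s \<in> V" for s
    using sum_g[OF s X(1), of 2] two K_subset[OF s] by auto
  have "X - {b} \<subseteq> N b" if b: "b \<in> X" for b
  proof -
    have bV: "b \<in> V" using b X by auto
    have "int (card (N b \<inter> (X - {b}))) = 4"
      using card_N_Int[OF bV, of "X - {b}"] sum8[OF bV] X b fX g_self[OF bV]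
      by (simp add: sum_diff1 Diff_mono)
    then have "N b \<inter> (X - {b}) = X - {b}"
      using X b fX by (intro card_subset_eq) auto
    then show ?thesis by auto
  qed
  moreover have "card (N b \<inter> X) = 2" if b: "b \<in> V - X" for b
    using card_N_Int[of b X] sum8[of b] X b by auto
  ultimately show ?thesis using X by (simp add: regular_clique_def)
qed

end

section \<open>Nonexistence of the transposed sesqui array\<close>

lemma no_transposed_sesqui_array:
  assumes S: "card S = 15"
  shows "\<not> transposed_sesqui_array 9 10 S 6 A"
proof
  assume "transposed_sesqui_array 9 10 S 6 A"
  then have D: "row_column_design 9 10 S 6 A" and "CC 9 10 A" "RC 9 10 A"
    by (auto simp: transposed_sesqui_array_def)
  define R C where "R = row_symbols 10 A" and "C = col_symbols 9 A"
  have fS: "finite S" and inS: "\<And>i j. i < 9 \<Longrightarrow> j < 10 \<Longrightarrow> A i j \<in> S"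
    and inj_row: "\<And>i. i < 9 \<Longrightarrow> inj_on (\<lambda>j. A i j) {..<10}"
    and inj_col: "\<And>j. j < 10 \<Longrightarrow> inj_on (\<lambda>i. A i j) {..<9}"
    and rep: "\<And>s. s \<in> S \<Longrightarrow> card {(i, j). i < 9 \<and> j < 10 \<and> A i j = s} = 6"
    using D by (auto simp: row_column_design_def)
  have R_eq: "R i = (\<lambda>j. A i j) ` {..<10}" and C_eq: "C j = (\<lambda>i. A i j) ` {..<9}" for i j
    by (auto simp: R_def C_def row_symbols_def col_symbols_def)
  have RS: "R i \<subseteq> S" "card (R i) = 10" "finite (R i)" if "i < 9" for i
    using inS that inj_row card_image[OF inj_row[OF that]] by (auto simp: R_eq)
  have CS: "C j \<subseteq> S" "card (C j) = 9" "finite (C j)" if "j < 10" for j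
    using inS that inj_col card_image[OF inj_col[OF that]] by (auto simp: C_eq)
  have rows: "card {i \<in> {..<9}. s \<in> R i} = 6" if s: "s \<in> S" for s
  proof -
    let ?O = "{(i, j). i < 9 \<and> j < 10 \<and> A i j = s}"
    have "fst ` ?O = {i \<in> {..<9}. s \<in> R i}" by (force simp: R_eq)
    \<comment> \<open>No symbol repeats within a row, so its occurrences correspond to the rows
      containing it.\<close>
    moreover have "inj_on fst ?O"
      using inj_row by (auto simp: inj_on_def)
    ultimately show ?thesis using rep[OF s] card_image[of fst ?O] by simp
  qed
  have cols: "card {j \<in> {..<10}. s \<in> C j} = 6" if s: "s \<in> S" for s
  proof -
    let ?O = "{(i, j). i < 9 \<and> j < 10 \<and> A i j = s}"
    have "snd ` ?O = {j \<in> {..<10}. s \<in> C j}" by (force simp: C_eq)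
    moreover have "inj_on snd ?O"
      using inj_col by (auto simp: inj_on_def)
    ultimately show ?thesis using rep[OF s] card_image[of snd ?O] by simp
  qed
  have cc: "card (C j \<inter> C j') = 5" if j: "j < 10" "j' < 10" "j \<noteq> j'" for j j'
  proof -
    obtain l where l: "\<And>j j'. j < 10 \<Longrightarrow> j' < 10 \<Longrightarrow> j \<noteq> j' \<Longrightarrow> card (C j \<inter> C j') = l"
      using \<open>CC 9 10 A\<close> by (auto simp: CC_def C_def)
    \<comment> \<open>Nine symbols lie in six columns each. Column \<open>j\<close> itself accounts
      for 9 of the 54 incidences, which leaves 45 for nine columns.\<close>
    have "54 = (\<Sum>s\<in>C j. card {k \<in> {..<10}. s \<in> C k})"
      using cols CS[OF j(1)] by (simp add: subset_iff)
    also have "\<dots> = (\<Sum>k<10. card (C k \<inter> C j))"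
      using CS[OF j(1)] by (simp add: sum_card_Int_swap)
    also have "\<dots> = card (C j \<inter> C j) + (\<Sum>k\<in>{..<10} - {j}. card (C k \<inter> C j))"
      using j by (intro sum.remove) auto
    also have "\<dots> = 9 + 9 * l"
      using j l CS[OF j(1)] by simp
    finally show ?thesis using l[OF j] by simp
  qed
  have rc: "card (R i \<inter> C j) = 6" if ij: "i < 9" "j < 10" for i j
  proof -
    obtain l where l: "\<And>i j. i < 9 \<Longrightarrow> j < 10 \<Longrightarrow> card (R i \<inter> C j) = l"
      using \<open>RC 9 10 A\<close> by (auto simp: RC_def R_def C_def)
    \<comment> \<open>The same count against the nine rows gives the constant 54 / 9.\<close>
    have "54 = (\<Sum>s\<in>C j. card {k \<in> {..<9}. s \<in> R k})"
      using rows CS[OF ij(2)] by (simp add: subset_iff)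
    also have "\<dots> = (\<Sum>k<9. card (R k \<inter> C j))"
      using CS[OF ij(2)] by (simp add: sum_card_Int_swap)
    also have "\<dots> = 9 * l" using ij l by simp
    finally show ?thesis using l[OF ij] by simp
  qed
  define K where "K s = {j \<in> {..<10}. s \<notin> C j}" for s
  have compl: "card {x \<in> U. \<not> Q x} = card U - card {x \<in> U. Q x}" if "finite U"
    for U :: "'x set" and Q
  proof -
    have "{x \<in> U. \<not> Q x} = U - {x \<in> U. Q x}" by auto
    then show ?thesis using that by (simp add: card_Diff_subset)
  qed
  \<comment> \<open>Applied to two columns this gives 15 - 9 - 9 + 5 = 2, the pair count of the
    design; applied to a row and a column, 15 - 10 - 9 + 6 = 2, the clique condition.\<close>
  have compl2: "int (card (S - (E \<union> F))) = 15 - int (card E) - int (card F) + int (card (E \<inter> F))"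
    if "E \<subseteq> S" "F \<subseteq> S" for E F
  proof -
    have f: "finite E" "finite F" using that fS finite_subset by auto
    have "card (S - (E \<union> F)) = 15 - card (E \<union> F)"
      using that f S by (simp add: card_Diff_subset)
    moreover have "card (E \<union> F) \<le> 15"
      using that fS S by (metis Un_least card_mono)
    ultimately show ?thesis using card_Un_Int[OF f] by linarith
  qed
  interpret design_10_4_2 S "{..<10::nat}" K
  proof
    show "finite S" "card S = 15" "finite {..<10::nat}" using fS S by auto
    show "K s \<subseteq> {..<10}" for s by (auto simp: K_def)
    show "card (K s) = 4" if "s \<in> S" for s
      using cols[OF that] compl[of "{..<10::nat}" "\<lambda>j. s \<in> C j"] by (simp add: K_def)
    show "card {s \<in> S. p \<in> K s} = 6" if "p \<in> {..<10}" for p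
    proof -
      have "{s \<in> S. p \<in> K s} = S - C p" using that by (auto simp: K_def)
      then show ?thesis using that CS[of p] S by (simp add: card_Diff_subset)
    qed
    show "card {s \<in> S. p \<in> K s \<and> q \<in> K s} = 2"
      if "p \<in> {..<10}" "q \<in> {..<10}" "p \<noteq> q" for p q
    proof -
      have "{s \<in> S. p \<in> K s \<and> q \<in> K s} = S - (C p \<union> C q)" using that by (auto simp: K_def)
      then show ?thesis using that CS[of p] CS[of q] cc[of p q] compl2[of "C p" "C q"] by simp
    qed
  qed
  show False
  proof (rule no_triple_cover)
    show "regular_clique (S - R i)" if i: "i < 9" for i
    proof (rule regular_cliqueI)
      show "S - R i \<subseteq> S" "card (S - R i) = 5"
        using RS[OF i] S by (auto simp: card_Diff_subset)
      show "card {t \<in> S - R i. p \<in> K t} = 2" if "p \<in> {..<10}" for p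
      proof -
        have "{t \<in> S - R i. p \<in> K t} = S - (R i \<union> C p)" using that by (auto simp: K_def)
        then show ?thesis
          using that RS[OF i] CS[of p] rc[OF i, of p] compl2[of "R i" "C p"] by simp
      qed
    qed
    show "card {i \<in> {..<9}. v \<in> S - R i} = 3" if "v \<in> S" for v
      using rows[OF that] compl[of "{..<9::nat}" "\<lambda>i. v \<in> R i"] that by simp
  qed
qed

section \<open>An explicit proper AO-array\<close>

definition ao_rows :: "nat list list" where
  "ao_rows =
    [[12, 6, 14, 7, 13, 9, 8, 5, 11, 10],
     [8, 9, 7, 13, 5, 12, 10, 14, 6, 11],
     [13, 14, 11, 8, 9, 10, 12, 6, 5, 7],
     [14, 11, 12, 3, 10, 0, 13, 4, 1, 2],
     [3, 13, 1, 12, 14, 4, 2, 11, 10, 0],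
     [2, 1, 4, 11, 3, 14, 0, 10, 13, 12],
     [7, 4, 9, 6, 8, 2, 5, 0, 3, 1],
     [9, 8, 6, 2, 4, 7, 3, 1, 0, 5],
     [4, 3, 2, 1, 0, 5, 7, 9, 8, 6]]"

definition ao_cols :: "nat list list" where
  "ao_cols = map (\<lambda>j. map (\<lambda>r. r ! j) ao_rows) [0..<10]"

text \<open>The parts are 0-4, 5-9 and 10-14. A row is the union of two parts and a column has three
  symbols in each part, so they share 3 + 3 = 6.\<close>

lemma ao_check:
  "length ao_rows = 9"
  "list_all (\<lambda>r. length r = 10 \<and> distinct r \<and> list_all (\<lambda>x. x < 15) r) ao_rows"
  "list_all distinct ao_cols"
  "list_all (\<lambda>k. length (filter (\<lambda>(i, j). ao_rows ! i ! j = k)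
     (List.product [0..<9] [0..<10])) = 6) [0..<15]"
  "list_all (\<lambda>r. list_all (\<lambda>c. length (filter (\<lambda>x. x \<in> set c) r) = 6) ao_cols) ao_rows"
  by code_simp+

text \<open>Witnesses against (RR) and (CC). Rows 0 and 1 avoid the same part, rows 0 and 3
  different ones. In every part, the pairs avoided by columns 0 and 1 overlap in one symbol, leaving
  two shared symbols; those avoided by columns 0 and 9 are disjoint, leaving one.\<close>

lemma ao_values:
  "length (filter (\<lambda>x. x \<in> set (ao_rows ! 1)) (ao_rows ! 0)) = 10"
  "length (filter (\<lambda>x. x \<in> set (ao_rows ! 3)) (ao_rows ! 0)) = 5"
  "length (filter (\<lambda>x. x \<in> set (ao_cols ! 1)) (ao_cols ! 0)) = 6"
  "length (filter (\<lambda>x. x \<in> set (ao_cols ! 9)) (ao_cols ! 0)) = 3"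
  by code_simp+

lemma ex_proper_AO_array:
  assumes S: "card S = 15"
  shows "\<exists>A. proper_AO_array 9 10 S 6 A"
proof -
  have fS: "finite S" using S by (simp add: card_ge_0_finite)
  \<comment> \<open>The numeric array is transported to the arbitrary symbol set along a
    bijection.\<close>
  obtain f where f: "bij_betw f {..<15::nat} S"
    using ex_bij_betw_nat_finite[OF fS] S by (auto simp: atLeast0LessThan)
  define A where "A i j = f (ao_rows ! i ! j)" for i j
  have len: "length (ao_rows ! i) = 10" and dist: "distinct (ao_rows ! i)"
    and lt: "set (ao_rows ! i) \<subseteq> {..<15}" if "i < 9" for i
    using that ao_check(1,2) by (auto simp: list_all_iff dest!: nth_mem)
  have col: "ao_cols ! j = map (\<lambda>r. r ! j) ao_rows" if "j < 10" for j
    using that by (simp add: ao_cols_def)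
  have col_nth: "ao_cols ! j ! i = ao_rows ! i ! j" "length (ao_cols ! j) = 9"
    if "i < 9" "j < 10" for i j
    using that by (simp_all add: col ao_check(1))
  have dist_col: "distinct (ao_cols ! j)" if "j < 10" for j
    using that ao_check(3) by (simp add: list_all_iff ao_cols_def)
  have lt_nth: "ao_rows ! i ! j < 15" if "i < 9" "j < 10" for i j
    using lt[OF that(1)] len[OF that(1)] that(2) by (metis lessThan_iff nth_mem subsetD)
  have inj: "inj_on f {..<15}" and onto: "f ` {..<15} = S"
    using f by (auto simp: bij_betw_def)
  have f_eq: "f x = f y \<longleftrightarrow> x = y" if "x < 15" "y < 15" for x y
    using inj that by (auto simp: inj_on_def)
  have set_row: "set (ao_rows ! i) = (\<lambda>j. ao_rows ! i ! j) ` {..<10}" if "i < 9" for i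
    using len[OF that] by (auto simp: set_conv_nth)
  have set_col: "set (ao_cols ! j) = (\<lambda>i. ao_rows ! i ! j) ` {..<9}" if "j < 10" for j
  proof -
    have "set ao_rows = (!) ao_rows ` {..<9}" by (auto simp: set_conv_nth ao_check(1))
    then show ?thesis by (simp add: col[OF that] image_image)
  qed
  have R: "row_symbols 10 A i = f ` set (ao_rows ! i)" if "i < 9" for i
    by (auto simp: row_symbols_def A_def set_row[OF that])
  have C: "col_symbols 9 A j = f ` set (ao_cols ! j)" if "j < 10" for j
    by (auto simp: col_symbols_def A_def set_col[OF that])
  have lt_col: "set (ao_cols ! j) \<subseteq> {..<15}" if "j < 10" for j
    using that lt_nth by (auto simp: set_col)
  \<comment> \<open>Turns intersections of symbol sets into the list lengths that were evaluated
    above.\<close>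
  have inter: "card (f ` set xs \<inter> f ` set ys) = length (filter (\<lambda>x. x \<in> set ys) xs)"
    if "set xs \<subseteq> {..<15}" "set ys \<subseteq> {..<15}" "distinct xs" for xs ys
  proof -
    have "f ` set xs \<inter> f ` set ys = f ` (set xs \<inter> set ys)"
      using inj that by (simp add: inj_on_image_Int)
    also have "card \<dots> = card (set xs \<inter> set ys)"
      using inj that by (intro card_image) (auto intro: inj_on_subset)
    also have "set xs \<inter> set ys = set (filter (\<lambda>x. x \<in> set ys) xs)" by auto
    also have "card \<dots> = length (filter (\<lambda>x. x \<in> set ys) xs)"
      using that by (intro distinct_card) simp
    finally show ?thesis .
  qed
  have "row_column_design 9 10 S 6 A"
    unfolding row_column_design_def
  proof (intro conjI allI impI ballI)
    show "finite S" by (rule fS)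
    show "A i j \<in> S" if "i < 9" "j < 10" for i j
      using lt_nth[OF that] onto by (auto simp: A_def)
    show "inj_on (\<lambda>j. A i j) {..<10}" if "i < 9" for i
      using that lt_nth dist len by (auto simp: inj_on_def A_def f_eq nth_eq_iff_index_eq)
    show "inj_on (\<lambda>i. A i j) {..<9}" if "j < 10" for j
    proof (rule inj_onI)
      fix i i' assume *: "i \<in> {..<9}" "i' \<in> {..<9}" "A i j = A i' j"
      then have "ao_cols ! j ! i = ao_cols ! j ! i'"
        using that lt_nth by (simp add: A_def f_eq col_nth)
      then show "i = i'"
        using * that dist_col[OF that] col_nth(2) by (simp add: nth_eq_iff_index_eq)
    qed
    show "card {(i, j). i < 9 \<and> j < 10 \<and> A i j = s} = 6" if s: "s \<in> S" for s
    proof -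
      obtain k where k: "k < 15" "s = f k" using s onto by auto
      have "{(i, j). i < 9 \<and> j < 10 \<and> A i j = s} =
          set (filter (\<lambda>(i, j). ao_rows ! i ! j = k) (List.product [0..<9] [0..<10]))"
        using k lt_nth by (auto simp: A_def f_eq)
      also have "card \<dots> = length (filter (\<lambda>(i, j). ao_rows ! i ! j = k)
          (List.product [0..<9] [0..<10]))"
        by (intro distinct_card distinct_filter distinct_product) auto
      also have "\<dots> = 6" using ao_check(4) k by (simp add: list_all_iff)
      finally show ?thesis .
    qed
  qed
  moreover have "RC 9 10 A"
    unfolding RC_def
  proof (intro exI allI impI)
    fix i j :: nat assume ij: "i < 9" "j < 10"
    then have "ao_rows ! i \<in> set ao_rows" "ao_cols ! j \<in> set ao_cols"
      by (auto simp: ao_check(1) ao_cols_def)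
    then show "card (row_symbols 10 A i \<inter> col_symbols 9 A j) = 6"
      using ij ao_check(5) inter lt lt_col dist by (simp add: R C list_all_iff)
  qed
  moreover have "\<not> RR 9 10 A"
  proof
    assume "RR 9 10 A"
    then obtain l where l: "\<And>i i'. i < 9 \<Longrightarrow> i' < 9 \<Longrightarrow> i \<noteq> i' \<Longrightarrow>
        card (row_symbols 10 A i \<inter> row_symbols 10 A i') = l"
      by (auto simp: RR_def)
    show False
      using l[of 0 1] l[of 0 3] inter lt dist ao_values(1,2) by (simp add: R)
  qed
  moreover have "\<not> CC 9 10 A"
  proof
    assume "CC 9 10 A"
    then obtain l where l: "\<And>j j'. j < 10 \<Longrightarrow> j' < 10 \<Longrightarrow> j \<noteq> j' \<Longrightarrow>
        card (col_symbols 9 A j \<inter> col_symbols 9 A j') = l"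
      by (auto simp: CC_def)
    show False
      using l[of 0 1] l[of 0 9] inter lt_col dist_col ao_values(3,4) by (simp add: C)
  qed
  ultimately show ?thesis by (auto simp: proper_AO_array_def)
qed

theorem mainTheorem6:
  fixes S :: "'a set"
  assumes "card S = 15"
  shows "(\<nexists>A. transposed_sesqui_array 9 10 S 6 A) \<and> (\<exists>A. proper_AO_array 9 10 S 6 A)"
  using no_transposed_sesqui_array[OF assms] ex_proper_AO_array[OF assms] by blast

end
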